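(* Let $a\ge 0$ and let $(X,d_{\mathbf o},a)$ be an O-complete $a$-upward $\mathbf o$-metric space, where $\mathbf o:[a,\infty)\times[a,\infty)\to[a,\infty)$ is nondecreasing in both variables, continuous at $(a,a)$, and satisfies $\mathbf o(a,a)=a$. Let $\varphi:[0,\infty)\times[a,\infty)\to[a,\infty)$ satisfy: ($\varphi_1$) $\varphi(0,t)=\varphi(r,a)=a$ for all $t\ge a$, $r\ge 0$; ($\varphi_2$) $\varphi|_{(0,\infty)\times(a,\infty)}$ is increasing in both variables, and $\varphi$ is continuous in the second variable at $a$; ($\varphi_3$) $\varphi(r_1,\varphi(r_2,t))=\varphi(r_1r_2,t)$ for all $r_1,r_2\in[0,\infty)$ and $t\in[a,\infty)$. Let $\kappa:=\sup C_\varphi$, let $0\le k<1$ with $k<\kappa$, and let $T:X\to X$ satisfy $d_{\mathbf o}(Tx,Ty)\le\varphi(k,d_{\mathbf o}(x,y))$ for all $x,y\in X$. Then $T$ has a unique fixed point.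
   Context: O-metric: let $X$ be a nonempty set, $a\ge 0$, and $\mathbf o:[a,\infty)\times[a,\infty)\to[a,\infty)$ a function, also written as a binary operation $u\,\mathbf o\,v=\mathbf o(u,v)$. $(X,d_{\mathbf o},a)$ is an $a$-upward $\mathbf o$-metric space if $d_{\mathbf o}:X\times X\to[a,\infty)$ satisfies, for all $x,y,z\in X$: (i) $d_{\mathbf o}(x,y)=a$ iff $x=y$; (ii) $d_{\mathbf o}(x,y)=d_{\mathbf o}(y,x)$; (iii) $d_{\mathbf o}(x,z)\le \mathbf o(d_{\mathbf o}(x,y),d_{\mathbf o}(y,z))$. A sequence $(x_n)$ O-converges to $x$ if $\lim_n d_{\mathbf o}(x_n,x)=a$; it is Cauchy if $\lim_{n,m\to\infty}d_{\mathbf o}(x_n,x_m)=a$. The space is O-complete if the Cauchy sequences are exactly the O-convergent sequences. "Increasing" means strictly increasing. Continuity of $\varphi$ in the second variable at $a$ means that for each $r>0$ the map $t\mapsto\varphi(r,t)$ is continuous at $t=a$. For $i\ge 0$, $\Omega_i$ is the (finite) set of all functions $h:[a,\infty)^{i+1}\to[a,\infty)$ of the form $h(t_0,\dots,t_i)=t_0\,\mathbf o\,t_1\,\mathbf o\cdots\mathbf o\,t_i$ obtained from all possible ways of placing parentheses (order of arguments kept); $\Omega_0$ consists of the identity. $C_\varphi$ is the set of all $r\ge 0$ such that for every $\epsilon\ge a$, $\lim_{n,i\to\infty}h_{n,i}(r,\epsilon)=a$, where $h_{n,i}(r,\epsilon)=h(\varphi(r^n,\epsilon),\varphi(r^{n+1},\epsilon),\dots,\varphi(r^{n+i},\epsilon))$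 for some $h\in\Omega_i$ (i.e. the limit holds for some choice of the functions $h\in\Omega_i$). *)

theory Defs
  imports "HOL-Analysis.Analysis"
begin

text \<open>
  Functions with domain \<open>[a,\<infinity>)\<close>, \<open>[0,\<infinity>)\<close> or \<open>X\<close> are represented by total functions
  that are only constrained on their domain; all quantifiers below are relativised accordingly.
\<close>

definition o_metric_space ::
  "'a set \<Rightarrow> ('a \<Rightarrow> 'a \<Rightarrow> real) \<Rightarrow> (real \<Rightarrow> real \<Rightarrow> real) \<Rightarrow> real \<Rightarrow> bool" where
  "o_metric_space X d opr a \<longleftrightarrow>
     X \<noteq> {} \<and> a \<ge> 0 \<and>
     (\<forall>u\<ge>a. \<forall>v\<ge>a. opr u v \<ge> a) \<and>
     (\<forall>x\<in>X. \<forall>y\<in>X. d x y \<ge> a) \<and>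
     (\<forall>x\<in>X. \<forall>y\<in>X. d x y = a \<longleftrightarrow> x = y) \<and>
     (\<forall>x\<in>X. \<forall>y\<in>X. d x y = d y x) \<and>
     (\<forall>x\<in>X. \<forall>y\<in>X. \<forall>z\<in>X. d x z \<le> opr (d x y) (d y z))"

definition O_converges ::
  "('a \<Rightarrow> 'a \<Rightarrow> real) \<Rightarrow> real \<Rightarrow> (nat \<Rightarrow> 'a) \<Rightarrow> 'a \<Rightarrow> bool" where
  "O_converges d a s x \<longleftrightarrow> (\<lambda>n. d (s n) x) \<longlonglongrightarrow> a"

definition O_Cauchy ::
  "('a \<Rightarrow> 'a \<Rightarrow> real) \<Rightarrow> real \<Rightarrow> (nat \<Rightarrow> 'a) \<Rightarrow> bool" where
  "O_Cauchy d a s \<longleftrightarrow>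
     ((\<lambda>(n, m). d (s n) (s m)) \<longlongrightarrow> a) (sequentially \<times>\<^sub>F sequentially)"

definition O_complete ::
  "'a set \<Rightarrow> ('a \<Rightarrow> 'a \<Rightarrow> real) \<Rightarrow> real \<Rightarrow> bool" where
  "O_complete X d a \<longleftrightarrow>
     (\<forall>s. (\<forall>n. s n \<in> X) \<longrightarrow> (O_Cauchy d a s \<longleftrightarrow> (\<exists>x\<in>X. O_converges d a s x)))"

text \<open>
  \<open>Omega opr i\<close> is the set of all bracketings of \<open>t\<^sub>0 opr t\<^sub>1 opr \<dots> opr t\<^sub>i\<close>. The argument tuple is
  given as a sequence of which only the entries \<open>t 0, \<dots>, t i\<close> are used. In the second rule the
  outermost operation combines a bracketing of the first \<open>i + 1\<close> arguments with one of the
  remaining \<open>j + 1\<close> arguments.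
\<close>

inductive_set Omega_rel ::
  "(real \<Rightarrow> real \<Rightarrow> real) \<Rightarrow> (nat \<times> ((nat \<Rightarrow> real) \<Rightarrow> real)) set"
  for opr :: "real \<Rightarrow> real \<Rightarrow> real" where
  single: "(0, \<lambda>t. t 0) \<in> Omega_rel opr"
| split: "\<lbrakk>(i, g) \<in> Omega_rel opr; (j, h) \<in> Omega_rel opr\<rbrakk> \<Longrightarrow>
    (i + j + 1, \<lambda>t. opr (g t) (h (\<lambda>m. t (i + 1 + m)))) \<in> Omega_rel opr"

definition Omega ::
  "(real \<Rightarrow> real \<Rightarrow> real) \<Rightarrow> nat \<Rightarrow> ((nat \<Rightarrow> real) \<Rightarrow> real) set" where
  "Omega opr i = {h. (i, h) \<in> Omega_rel opr}"

text \<open>The bracketing may depend on \<open>n\<close>, \<open>i\<close> and also on \<open>r\<close>, \<open>\<epsilon>\<close>.\<close>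

definition C_set ::
  "(real \<Rightarrow> real \<Rightarrow> real) \<Rightarrow> real \<Rightarrow> (real \<Rightarrow> real \<Rightarrow> real) \<Rightarrow> real set" where
  "C_set opr a \<phi> = {r. r \<ge> 0 \<and>
     (\<forall>\<epsilon>\<ge>a. \<exists>h. (\<forall>n i. h n i \<in> Omega opr i) \<and>
        ((\<lambda>(n, i). h n i (\<lambda>j. \<phi> (r ^ (n + j)) \<epsilon>)) \<longlongrightarrow> a)
          (sequentially \<times>\<^sub>F sequentially))}"

text \<open>The supremum is taken in the extended reals, since \<open>C_set opr a \<phi>\<close> may be unbounded.\<close>

definition kappa ::
  "(real \<Rightarrow> real \<Rightarrow> real) \<Rightarrow> real \<Rightarrow> (real \<Rightarrow> real \<Rightarrow> real) \<Rightarrow> ereal" where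
  "kappa opr a \<phi> = (SUP r\<in>C_set opr a \<phi>. ereal r)"

end

theory Submission imports Defs begin

text \<open>
  Along a Picard orbit \<open>x\<^sub>n\<close> of \<open>T\<close> consecutive distances are at most \<open>\<phi> (k ^ n) \<epsilon>\<close>, hence at most
  \<open>\<phi> (r ^ n) \<epsilon>\<close> for some \<open>r \<in> C\<^sub>\<phi>\<close> with \<open>r > k\<close>. Every bracketing yields an iterated triangle
  inequality, so \<open>d x\<^sub>n x\<^sub>n\<^sub>+\<^sub>i\<^sub>+\<^sub>1\<close> tends to \<open>a\<close> as \<open>n\<close> and \<open>i\<close> both tend to infinity. This says nothing
  about pairs of indices with a bounded gap; those are handled by a detour through
  the far point \<open>x\<^sub>n\<^sub>+\<^sub>m\<^sub>+\<^sub>1\<close> and continuity of the operation at \<open>(a, a)\<close>.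
\<close>

text \<open>The operation is monotone only on arguments at least \<open>a\<close>, so the lower
  bound on the value of a bracketing has to be carried through the induction together with
  monotonicity.\<close>

lemma Omega_rel_mono:
  assumes "(i, h) \<in> Omega_rel opr"
    and range: "\<And>u v. a \<le> u \<Longrightarrow> a \<le> v \<Longrightarrow> a \<le> opr u v"
    and mono: "\<And>u u' v v'. a \<le> u \<Longrightarrow> u \<le> u' \<Longrightarrow> a \<le> v \<Longrightarrow> v \<le> v' \<Longrightarrow> opr u v \<le> opr u' v'"
    and "\<And>j. a \<le> s j" "\<And>j. s j \<le> t j"
  shows "a \<le> h s \<and> h s \<le> h t"
  using assms(1,4,5)
proof (induction arbitrary: s t rule: Omega_rel.induct)
  case single
  then show ?case by simp
next
  case (split i g j h)
  have "a \<le> g s \<and> g s \<le> g t"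
    using split.IH(1) split.prems by blast
  moreover have "a \<le> h (\<lambda>m. s (i + 1 + m)) \<and> h (\<lambda>m. s (i + 1 + m)) \<le> h (\<lambda>m. t (i + 1 + m))"
    using split.IH(2)[of "\<lambda>m. s (i + 1 + m)" "\<lambda>m. t (i + 1 + m)"] split.prems by blast
  ultimately show ?case
    by (simp add: range mono)
qed

text \<open>The outermost operation of a bracketing splits the path at \<open>x (n + i + 1)\<close>,
  where the triangle inequality applies. The right factor starts there, so \<open>n\<close> varies
  in the induction. A bracketing in \<open>Omega opr i\<close> takes \<open>i + 1\<close> steps,
  hence the end index \<open>n + i + 1\<close>.\<close>

lemma Omega_rel_triangle:
  assumes "(i, h) \<in> Omega_rel opr"
    and d_ge: "\<And>m n. a \<le> d (x m) (x n)"
    and triangle: "\<And>l m n. d (x l) (x n) \<le> opr (d (x l) (x m)) (d (x m) (x n))"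
    and mono: "\<And>u u' v v'. a \<le> u \<Longrightarrow> u \<le> u' \<Longrightarrow> a \<le> v \<Longrightarrow> v \<le> v' \<Longrightarrow> opr u v \<le> opr u' v'"
  shows "d (x n) (x (n + i + 1)) \<le> h (\<lambda>j. d (x (n + j)) (x (n + j + 1)))"
  using assms(1)
proof (induction arbitrary: n rule: Omega_rel.induct)
  case single
  then show ?case by simp
next
  case (split i g j h)
  let ?p = "n + i + 1"
  have "d (x n) (x (n + (i + j + 1) + 1)) \<le> opr (d (x n) (x ?p)) (d (x ?p) (x (?p + j + 1)))"
    using triangle[of n "?p + j + 1" ?p] by (simp add: add_ac)
  also have "\<dots> \<le> opr (g (\<lambda>j. d (x (n + j)) (x (n + j + 1))))
      (h (\<lambda>j. d (x (?p + j)) (x (?p + j + 1))))"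
    by (intro mono d_ge split.IH)
  finally show ?case
    by (simp add: add_ac)
qed

theorem theorem5p1:
  fixes X :: "'a set" and d :: "'a \<Rightarrow> 'a \<Rightarrow> real" and opr :: "real \<Rightarrow> real \<Rightarrow> real"
    and a k :: real and \<phi> :: "real \<Rightarrow> real \<Rightarrow> real" and T :: "'a \<Rightarrow> 'a"
  assumes space: "o_metric_space X d opr a"
    and complete: "O_complete X d a"
    and opr_mono1: "\<And>v. v \<ge> a \<Longrightarrow> mono_on {a..} (\<lambda>u. opr u v)"
    and opr_mono2: "\<And>u. u \<ge> a \<Longrightarrow> mono_on {a..} (\<lambda>v. opr u v)"
    and opr_cont: "continuous (at (a, a) within {a..} \<times> {a..}) (\<lambda>(u, v). opr u v)"
    and opr_aa: "opr a a = a"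
    and phi_range: "\<And>r t. r \<ge> 0 \<Longrightarrow> t \<ge> a \<Longrightarrow> \<phi> r t \<ge> a"
    and phi1_left: "\<And>t. t \<ge> a \<Longrightarrow> \<phi> 0 t = a"
    and phi1_right: "\<And>r. r \<ge> 0 \<Longrightarrow> \<phi> r a = a"
    and phi2_mono1: "\<And>t. t > a \<Longrightarrow> strict_mono_on {0<..} (\<lambda>r. \<phi> r t)"
    and phi2_mono2: "\<And>r. r > 0 \<Longrightarrow> strict_mono_on {a<..} (\<lambda>t. \<phi> r t)"
    and phi2_cont: "\<And>r. r > 0 \<Longrightarrow> continuous (at a within {a..}) (\<lambda>t. \<phi> r t)"
    and phi3: "\<And>r1 r2 t. r1 \<ge> 0 \<Longrightarrow> r2 \<ge> 0 \<Longrightarrow> t \<ge> a \<Longrightarrow> \<phi> r1 (\<phi> r2 t) = \<phi> (r1 * r2) t"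
    and k: "0 \<le> k" "k < 1" "ereal k < kappa opr a \<phi>"
    and T_map: "T \<in> X \<rightarrow> X"
    and T_contr: "\<And>x y. x \<in> X \<Longrightarrow> y \<in> X \<Longrightarrow> d (T x) (T y) \<le> \<phi> k (d x y)"
  shows "\<exists>!x. x \<in> X \<and> T x = x"
proof -
  have d_ge: "a \<le> d x y" if "x \<in> X" "y \<in> X" for x y
    using space that by (simp add: o_metric_space_def)
  have d_eq: "d x y = a \<longleftrightarrow> x = y" if "x \<in> X" "y \<in> X" for x y
    using space that by (simp add: o_metric_space_def)
  have d_sym: "d x y = d y x" if "x \<in> X" "y \<in> X" for x y
    using space that by (simp add: o_metric_space_def)
  have triangle: "d x z \<le> opr (d x y) (d y z)" if "x \<in> X" "y \<in> X" "z \<in> X" for x y z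
    using space that by (simp add: o_metric_space_def)
  have opr_ge: "a \<le> opr u v" if "a \<le> u" "a \<le> v" for u v
    using space that by (simp add: o_metric_space_def)
  have opr_mono: "opr u v \<le> opr u' v'" if "a \<le> u" "u \<le> u'" "a \<le> v" "v \<le> v'" for u u' v v'
  proof -
    have "opr u v \<le> opr u' v"
      using mono_onD[OF opr_mono1[of v], of u u'] that by simp
    also have "\<dots> \<le> opr u' v'"
      using mono_onD[OF opr_mono2[of u'], of v v'] that by simp
    finally show ?thesis .
  qed
  have opr_tendsto: "((\<lambda>w. opr (f w) (g w)) \<longlongrightarrow> a) F"
    if "(f \<longlongrightarrow> a) F" "(g \<longlongrightarrow> a) F" "\<And>w. a \<le> f w" "\<And>w. a \<le> g w"
    for f g :: "'b \<Rightarrow> real" and F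
  proof -
    have "((\<lambda>w. (f w, g w)) \<longlongrightarrow> (a, a)) F"
      by (intro tendsto_Pair that)
    then have "((\<lambda>w. (\<lambda>(u, v). opr u v) (f w, g w)) \<longlongrightarrow> (\<lambda>(u, v). opr u v) (a, a)) F"
      by (intro continuous_within_tendsto_compose'[OF opr_cont]) (use that in auto)
    then show ?thesis by (simp add: opr_aa)
  qed

  have phi_mono: "\<phi> r s \<le> \<phi> r' t" if "0 \<le> r" "r \<le> r'" "a \<le> s" "s \<le> t" for r r' s t
  \<comment> \<open>Strict monotonicity is given only for positive \<open>r\<close> and for
    arguments above \<open>a\<close>. On the boundary the left side equals \<open>a\<close>, the
    least possible value.\<close>
  proof (cases "r = 0 \<or> s = a")
    case True
    then show ?thesis
      using that phi1_left[of s] phi1_right[of r] phi_range[of r' t] by auto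
  next
    case False
    have "\<phi> r s \<le> \<phi> r' s"
      using strict_mono_onD[OF phi2_mono1[of s], of r r'] that False by (cases "r = r'") auto
    also have "\<dots> \<le> \<phi> r' t"
      using strict_mono_onD[OF phi2_mono2[of r'], of s t] that False by (cases "s = t") auto
    finally show ?thesis .
  qed
  have phi_less: "\<phi> r t < \<phi> 1 t" if "0 \<le> r" "r < 1" "a < t" for r t
  proof -
    \<comment> \<open>The midpoint is positive even for \<open>r = 0\<close>, so strict monotonicity
      can compare it with \<open>1\<close>.\<close>
    have "\<phi> r t \<le> \<phi> ((r + 1) / 2) t"
      using that by (intro phi_mono) auto
    also have "\<dots> < \<phi> 1 t"
      using strict_mono_onD[OF phi2_mono1[of t], of "(r + 1) / 2" 1] that by auto
    finally show ?thesis .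
  qed
  \<comment> \<open>\<open>\<phi> 1\<close> is idempotent by \<open>phi3\<close> and injective on \<open>{a<..}\<close>.\<close>
  have phi_one: "\<phi> 1 t = t" if "a \<le> t" for t
  proof (cases "t = a")
    case False
    then have "a < \<phi> 1 t"
      using phi_less[of 0 t] phi1_left[of t] that by auto
    moreover have "\<phi> 1 (\<phi> 1 t) = \<phi> 1 t"
      using phi3[of 1 1 t] that by simp
    ultimately show ?thesis
      using strict_mono_on_eqD[OF phi2_mono2[of 1], of "\<phi> 1 t" t] that False by auto
  qed (simp add: phi1_right)

  \<comment> \<open>The supremum only provides some member above \<open>k\<close>; the bounds in
    powers of \<open>k\<close> are later enlarged to powers of \<open>r\<close>.\<close>
  obtain r where r: "r \<in> C_set opr a \<phi>" and kr: "k < r"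
    using k(3) unfolding kappa_def by (auto simp: less_SUP_iff)

  obtain x0 where x0: "x0 \<in> X"
    using space by (auto simp: o_metric_space_def)
  define x where "x n = (T ^^ n) x0" for n
  have x_in: "x n \<in> X" for n
    by (induction n) (use x0 T_map in \<open>auto simp: x_def\<close>)
  have x_Suc: "x (Suc n) = T (x n)" for n
    by (simp add: x_def)
  define \<epsilon> where "\<epsilon> = d (x 0) (x 1)"
  have eps_ge: "a \<le> \<epsilon>"
    unfolding \<epsilon>_def by (intro d_ge x_in)
  \<comment> \<open>By \<open>phi3\<close> each application of the contraction multiplies the first
    argument of \<open>\<phi>\<close> by \<open>k\<close>; the start is
    \<open>\<phi> 1 \<epsilon> = \<epsilon>\<close>.\<close>
  have step: "d (x n) (x (n + 1)) \<le> \<phi> (k ^ n) \<epsilon>" for n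
  proof (induction n)
    case 0
    then show ?case
      by (simp add: phi_one eps_ge \<epsilon>_def[symmetric, simplified])
  next
    case (Suc n)
    have "d (x (Suc n)) (x (Suc n + 1)) \<le> \<phi> k (d (x n) (x (n + 1)))"
      using T_contr[OF x_in x_in, of n "n + 1"] by (simp add: x_Suc)
    also have "\<dots> \<le> \<phi> k (\<phi> (k ^ n) \<epsilon>)"
      by (intro phi_mono k order.refl d_ge x_in Suc)
    also have "\<dots> = \<phi> (k ^ Suc n) \<epsilon>"
      using phi3[of k "k ^ n" \<epsilon>] k eps_ge by simp
    finally show ?case .
  qed

  let ?F = "sequentially \<times>\<^sub>F sequentially"
  obtain h where h: "\<And>n i. h n i \<in> Omega opr i"
    and h_lim: "((\<lambda>(n, i). h n i (\<lambda>j. \<phi> (r ^ (n + j)) \<epsilon>)) \<longlongrightarrow> a) ?F"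
    using r eps_ge unfolding C_set_def by blast
  define D where "D = (\<lambda>(n, i). d (x n) (x (n + i + 1)))"
  have D_ge: "a \<le> D w" for w
    by (auto simp: D_def split: prod.split intro: d_ge x_in)
  have D_lim: "(D \<longlongrightarrow> a) ?F"
  proof (rule tendsto_sandwich[OF _ _ tendsto_const h_lim])
    show "eventually (\<lambda>w. a \<le> D w) ?F"
      by (simp add: D_ge)
    have "d (x n) (x (n + i + 1)) \<le> h n i (\<lambda>j. \<phi> (r ^ (n + j)) \<epsilon>)" for n i
    proof -
      have rel: "(i, h n i) \<in> Omega_rel opr"
        using h unfolding Omega_def by simp
      have "d (x n) (x (n + i + 1)) \<le> h n i (\<lambda>j. d (x (n + j)) (x (n + j + 1)))"
        using Omega_rel_triangle[where d = d and x = x, OF rel d_ge triangle opr_mono] x_in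
        by blast
      also have "\<dots> \<le> h n i (\<lambda>j. \<phi> (r ^ (n + j)) \<epsilon>)"
      proof -
        have "d (x (n + j)) (x (n + j + 1)) \<le> \<phi> (r ^ (n + j)) \<epsilon>" for j
          using step[of "n + j"] phi_mono[of "k ^ (n + j)" "r ^ (n + j)" \<epsilon> \<epsilon>]
            power_mono[of k r "n + j"] k kr eps_ge by simp
        then show ?thesis
          by (intro Omega_rel_mono[where a = a, OF rel, THEN conjunct2])
            (blast intro: opr_ge opr_mono d_ge x_in)+
      qed
      finally show ?thesis .
    qed
    then show "eventually (\<lambda>w. D w \<le> (\<lambda>(n, i). h n i (\<lambda>j. \<phi> (r ^ (n + j)) \<epsilon>)) w) ?F"
      by (simp add: D_def split_beta)
  qed
  have swap: "filterlim prod.swap ?F ?F"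
    unfolding prod.swap_def[abs_def] by (intro filterlim_Pair filterlim_fst filterlim_snd)
  have D_swap: "((\<lambda>w. D (prod.swap w)) \<longlongrightarrow> a) ?F"
    by (rule filterlim_compose[OF D_lim swap])
  have "((\<lambda>(n, m). d (x n) (x m)) \<longlongrightarrow> a) ?F"
  proof (rule tendsto_sandwich[OF _ _ tendsto_const opr_tendsto[OF D_lim D_swap D_ge D_ge]])
    show "eventually (\<lambda>w. a \<le> (\<lambda>(n, m). d (x n) (x m)) w) ?F"
      by (simp add: split_beta d_ge x_in)
    \<comment> \<open>The point \<open>x (n + m + 1)\<close> lies \<open>m + 1\<close> steps after
      \<open>x n\<close> and \<open>n + 1\<close> steps after \<open>x m\<close>. Both gaps grow
      with \<open>n\<close> and \<open>m\<close>, so \<open>D_lim\<close> controls both distances,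
      the second one after swapping coordinates.\<close>
    have "d (x n) (x m) \<le> opr (D (n, m)) (D (m, n))" for n m
      using triangle[OF x_in x_in x_in, of n m "n + m + 1"] d_sym[OF x_in x_in, of m "n + m + 1"]
      by (simp add: D_def add.commute)
    then show "eventually (\<lambda>w. (\<lambda>(n, m). d (x n) (x m)) w \<le> opr (D w) (D (prod.swap w))) ?F"
      by (intro always_eventually) auto
  qed
  then have "O_Cauchy d a x"
    unfolding O_Cauchy_def .
  then obtain y where y: "y \<in> X" and "O_converges d a x y"
    using complete x_in unfolding O_complete_def by blast
  then have lim: "(\<lambda>n. d (x n) y) \<longlonglongrightarrow> a"
    by (simp add: O_converges_def)
  have Ty: "T y \<in> X"
    using T_map y by blast
  have phi_lim: "(\<lambda>n. \<phi> k (d (x n) y)) \<longlonglongrightarrow> a"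
  \<comment> \<open>Continuity at \<open>a\<close> is given for positive first argument only;
    \<open>\<phi> 0\<close> is constantly \<open>a\<close>.\<close>
  proof (cases "k = 0")
    case True
    then show ?thesis
      by (simp add: phi1_left d_ge x_in y)
  next
    case False
    then have "(\<lambda>n. \<phi> k (d (x n) y)) \<longlonglongrightarrow> \<phi> k a"
      using k(1) d_ge[OF x_in y]
      by (intro continuous_within_tendsto_compose'[OF phi2_cont _ lim]) auto
    then show ?thesis
      using k(1) by (simp add: phi1_right)
  qed
  have "(\<lambda>n. opr (d (x (Suc n)) y) (\<phi> k (d (x n) y))) \<longlonglongrightarrow> a"
    using LIMSEQ_Suc[OF lim] phi_lim
    by (rule opr_tendsto) (auto intro!: d_ge x_in y phi_range k)
  moreover have "d y (T y) \<le> opr (d (x (Suc n)) y) (\<phi> k (d (x n) y))" for n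
  proof -
    have "d y (T y) \<le> opr (d (x (Suc n)) y) (d (x (Suc n)) (T y))"
      using triangle[OF y x_in Ty] d_sym[OF y x_in] by simp
    also have "\<dots> \<le> opr (d (x (Suc n)) y) (\<phi> k (d (x n) y))"
      using T_contr[OF x_in y, of n] by (intro opr_mono d_ge x_in y Ty order.refl) (simp add: x_Suc)
    finally show ?thesis .
  qed
  ultimately have "d y (T y) \<le> a"
    by (intro LIMSEQ_le_const) auto
  then have fixed: "T y = y"
    using d_ge[OF y Ty] d_eq[OF y Ty] by auto
  moreover have "z = y" if "z \<in> X" "T z = z" for z
  proof (rule ccontr)
    assume "z \<noteq> y"
    then have "a < d z y"
      using d_ge[OF that(1) y] d_eq[OF that(1) y] by auto
    \<comment> \<open>Since \<open>k < 1\<close>, \<open>\<phi> k t < \<phi> 1 t = t\<close> for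
      every \<open>t\<close> above \<open>a\<close>.\<close>
    then have "\<phi> k (d z y) < d z y"
      using phi_less[OF k(1,2)] phi_one by fastforce
    then show False
      using T_contr[OF that(1) y] that fixed by simp
  qed
  ultimately show ?thesis
    using y by blast
qed

end
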